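(* Let $\Omega\subset\mathbb{R}^n$ be compact, $f\in C(\Omega)$ real-valued, $\rho:\mathbb{R}\to\mathbb{R}$ monotonically (strictly) decreasing with $\rho(f(x))>0$ for every $x\in\Omega$, $\tau(x)=\rho(f(x))$, and for any $k\in\mathbb{R}$ let $$m^{(k)}(x)=\frac{\tau^k(x)}{\int_\Omega\tau^k(t)\,\mathrm{d}t},\qquad x\in\Omega .$$ Let $X^*$ be the set of all global minimizers of $f$ in $\Omega$. Then: (i) For $k>0$, the maximum of $m^{(k)}$ on $\Omega$ is $m^{(k)}(x^* )$ (for any $x^*\in X^*$) and the set of all maximizers of $m^{(k)}$ is $X^*$. (ii) For any $k\in\mathbb{R}$, $m^{(k)}$ is a probability density function on $\Omega$; especially, $m^{(0)}(x)=1/\mu(\Omega)$ is the probability density function of the continuous uniform distribution on $\Omega$. (iii) If $f\in C^1(\Omega)$, then $\nabla m^{(k)}(x)=k\,m^{(k)}(x)\,\nabla\tau(x)/\tau(x)$. (iv) Suppose $f\in C^2(\Omega)$. If $x_1^*,x_2^*\in X^*$ and $\nabla^2f(x_1^* )\succ\nabla^2f(x_2^* )\succ0$, then $\nabla^2m^{(k)}(x_1^* )\prec\nabla^2m^{(k)}(x_2^* )\prec0$. (v) For every $k\in\mathbb{R}$, it holds that $$\frac{\mathrm{d}}{\mathrm{d}k}m^{(k)}(x)=m^{(k)}(x)\Big(\log(\tau(x))-\mathbb{E}^{(k)}(\log(\tau))\Big).$$ (vi) If $X^*$ has zero $n$-dimensional Lebesgue measure, i.e., $\mu(X^* )=0$,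 then $\lim_{k\to\infty}m^{(k)}(x)=\infty$ for $x\in X^*$ and $\lim_{k\to\infty}m^{(k)}(x)=0$ for $x\in\Omega\setminus X^*$. (vii) If $X^*$ has nonzero $n$-dimensional Lebesgue measure, i.e., $\mu(X^* )>0$, then $\lim_{k\to\infty}m^{(k)}(x)=\frac{1}{\mu(X^* )}$ for $x\in X^*$ and $\lim_{k\to\infty}m^{(k)}(x)=0$ for $x\in\Omega\setminus X^*$.
   Context: $\mu$ denotes $n$-dimensional Lebesgue measure, $\mu(S)=\int_S\mathrm{d}t$; it is implicit in the definition of $m^{(k)}$ that $\mu(\Omega)>0$. The function $m^{(k)}$ is called the nascent minima distribution function related to $f$ and $\Omega$. For a function $h$ on $\Omega$, $\mathbb{E}^{(k)}(h)=\int_\Omega h(t)m^{(k)}(t)\,\mathrm{d}t$. For symmetric matrices, $A\succ0$ means $A$ is strictly positive definite, $A\succ B$ means $A-B\succ0$, and $A\prec B$ means $B\succ A$. $\nabla^2f$ and $\nabla^2m^{(k)}$ are the Hessians of $f$ and $m^{(k)}$.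
   Formalization: (iii) is claimed wherever ∇τ exists; (iv) assumes k>0, ρ is C^1 near f(Ω) with ρ'(min f)<0, and each x_i* is interior or has ∇f(x_i* )=0; in (vi) the limit 0 off X* assumes some x*∈X* all of whose neighbourhoods meet Ω in positive measure. *)

theory Defs
  imports "HOL-Analysis.Analysis" "HOL-Probability.Probability_Measure"
begin

definition global_minimizers :: "('a \<Rightarrow> real) \<Rightarrow> 'a set \<Rightarrow> 'a set" where
  "global_minimizers f S = {x. is_arg_min f (\<lambda>x. x \<in> S) x}"

definition global_maximizers :: "('a \<Rightarrow> real) \<Rightarrow> 'a set \<Rightarrow> 'a set" where
  "global_maximizers f S = {x. is_arg_max f (\<lambda>x. x \<in> S) x}"

definition tau :: "(real \<Rightarrow> real) \<Rightarrow> ('a \<Rightarrow> real) \<Rightarrow> 'a \<Rightarrow> real" where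
  "tau \<rho> f x = \<rho> (f x)"

text \<open>The nascent minima distribution function \<open>m\<^sup>(\<^sup>k\<^sup>)\<close> related to \<open>f\<close> and \<open>\<Omega>\<close>.
  Being a total function it also has values outside \<open>\<Omega>\<close>; these carry no meaning.\<close>

definition nascent ::
    "(real \<Rightarrow> real) \<Rightarrow> (real ^ 'n \<Rightarrow> real) \<Rightarrow> (real ^ 'n) set \<Rightarrow> real \<Rightarrow> real ^ 'n \<Rightarrow> real" where
  "nascent \<rho> f \<Omega> k x = tau \<rho> f x powr k / (LINT t:\<Omega>|lebesgue. tau \<rho> f t powr k)"

definition nascent_expectation ::
    "(real \<Rightarrow> real) \<Rightarrow> (real ^ 'n \<Rightarrow> real) \<Rightarrow> (real ^ 'n) set \<Rightarrow> real \<Rightarrow> (real ^ 'n \<Rightarrow> real) \<Rightarrow> real" where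
  "nascent_expectation \<rho> f \<Omega> k h = (LINT t:\<Omega>|lebesgue. h t * nascent \<rho> f \<Omega> k t)"

text \<open>The measurability clause is needed because \<^const>\<open>density\<close> is degenerate for
  non-measurable functions, the sign clause because \<^const>\<open>ennreal\<close> truncates at \<open>0\<close>.\<close>

definition probability_density_on :: "(real ^ 'n) set \<Rightarrow> (real ^ 'n \<Rightarrow> real) \<Rightarrow> bool" where
  "probability_density_on S p \<longleftrightarrow>
     p \<in> borel_measurable (lebesgue_on S) \<and> (\<forall>x\<in>S. 0 \<le> p x) \<and>
     prob_space (density (lebesgue_on S) (\<lambda>x. ennreal (p x)))"

text \<open>Derivatives are taken relative to \<open>S\<close>, so that they only depend on the values of the
  function on \<open>S\<close> and also make sense at boundary points. At interior points of \<open>S\<close> these are the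
  ordinary gradient and Hessian, and they are unique; at a boundary point of an irregular \<open>S\<close>
  there may be several. A function that extends to a \<open>C\<^sup>1\<close> (\<open>C\<^sup>2\<close>) function on a neighbourhood of
  \<open>S\<close> satisfies \<open>C1_on\<close> (\<open>C2_on\<close>) with the derivatives of the extension.\<close>

definition has_gradient :: "(real ^ 'n \<Rightarrow> real) \<Rightarrow> real ^ 'n \<Rightarrow> real ^ 'n \<Rightarrow> (real ^ 'n) set \<Rightarrow> bool" where
  "has_gradient f v x S \<longleftrightarrow> (f has_derivative (\<lambda>h. h \<bullet> v)) (at x within S)"

definition gradient_on :: "(real ^ 'n) set \<Rightarrow> (real ^ 'n \<Rightarrow> real) \<Rightarrow> (real ^ 'n \<Rightarrow> real ^ 'n) \<Rightarrow> bool" where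
  "gradient_on S f g \<longleftrightarrow> (\<forall>x\<in>S. has_gradient f (g x) x S)"

text \<open>If \<open>g\<close> is a gradient field of \<open>f\<close> on \<open>S\<close>, this says that \<open>A\<close> is the Hessian of \<open>f\<close> at \<open>x\<close>.\<close>

definition has_jacobian ::
    "(real ^ 'n \<Rightarrow> real ^ 'n) \<Rightarrow> real ^ 'n ^ 'n \<Rightarrow> real ^ 'n \<Rightarrow> (real ^ 'n) set \<Rightarrow> bool" where
  "has_jacobian g A x S \<longleftrightarrow> (g has_derivative (\<lambda>h. A *v h)) (at x within S)"

definition C1_on :: "(real ^ 'n) set \<Rightarrow> (real ^ 'n \<Rightarrow> real) \<Rightarrow> bool" where
  "C1_on S f \<longleftrightarrow> (\<exists>g. gradient_on S f g \<and> continuous_on S g)"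

text \<open>\<open>f\<close> is twice continuously differentiable on \<open>S\<close> with gradient \<open>g\<close> and Hessian \<open>H\<close>.\<close>

definition C2_on ::
    "(real ^ 'n) set \<Rightarrow> (real ^ 'n \<Rightarrow> real) \<Rightarrow> (real ^ 'n \<Rightarrow> real ^ 'n) \<Rightarrow> (real ^ 'n \<Rightarrow> real ^ 'n ^ 'n) \<Rightarrow> bool" where
  "C2_on S f g H \<longleftrightarrow>
     gradient_on S f g \<and> (\<forall>x\<in>S. has_jacobian g (H x) x S) \<and> continuous_on S H"

text \<open>A smooth strictly decreasing function may have a vanishing derivative at some points, which
  is why nonvanishing of the derivative at the point \<open>c\<close> is a separate clause.\<close>

definition regular_decreasing :: "(real \<Rightarrow> real) \<Rightarrow> real set \<Rightarrow> real \<Rightarrow> bool" where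
  "regular_decreasing \<rho> T c \<longleftrightarrow>
     (\<exists>U. open U \<and> T \<subseteq> U \<and> \<rho> differentiable_on U \<and> continuous_on U (deriv \<rho>)) \<and> deriv \<rho> c < 0"

definition pos_def :: "real ^ 'n ^ 'n \<Rightarrow> bool" where
  "pos_def A \<longleftrightarrow> transpose A = A \<and> (\<forall>v. v \<noteq> 0 \<longrightarrow> 0 < v \<bullet> (A *v v))"

definition loewner_less :: "real ^ 'n ^ 'n \<Rightarrow> real ^ 'n ^ 'n \<Rightarrow> bool" (infix "\<prec>\<^sub>L" 50) where
  "A \<prec>\<^sub>L B \<longleftrightarrow> pos_def (B - A)"

text \<open>Points of \<open>S\<close> all of whose neighbourhoods meet \<open>S\<close> in positive measure. If \<open>S\<close> is the
  closure of its interior, every point of \<open>S\<close> is of this kind.\<close>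

definition nonnegligible_points :: "(real ^ 'n) set \<Rightarrow> (real ^ 'n) set" where
  "nonnegligible_points S = {x \<in> S. \<forall>e>0. 0 < measure lebesgue (S \<inter> ball x e)}"

end

(* With b = max tau, the value of m^(k) at a minimizer is the reciprocal of the integral of
   (tau / b)^k, which decreases by dominated convergence to the measure of {tau = b} = argmin f. At a
   point x outside argmin f it suffices that some set of positive measure satisfies f <= s < f x, as
   the normalizing integral then grows at least like rho(s)^k, with rho(s) > tau(x). The level s
   between min f and f x makes continuity of rho unnecessary. The derivative in k comes from
   |e^y - 1 - y| <= y^2, which is uniform because log tau is bounded. For the Hessians, the gradient of
   m^(k) is a continuous factor times the gradient of f; at a minimizer the latter vanishes, so
   only the Hessian of f contributes and rho need not be twice differentiable. *)

theory Submission
  imports Defs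
begin

section \<open>Elementary estimates for exponentials and powers\<close>

lemma abs_exp_minus_linear_le:
  fixes y :: real
  assumes "\<bar>y\<bar> \<le> 1"
  shows "\<bar>exp y - 1 - y\<bar> \<le> y\<^sup>2"
proof (cases "0 \<le> y")
  case True
  then show ?thesis
    using exp_bound[of y] exp_ge_add_one_self[of y] assms zero_le_power2[of y] by linarith
next
  case False
  define a where "a = - y"
  have a: "0 < a" "a \<le> 1"
    using False assms by (auto simp: a_def)
  \<comment> \<open>Factoring \<open>1 + a ^ 3\<close> lets the lower bound
    \<open>1 + a \<le> exp a\<close> be inverted into the upper bound
    \<open>1 - a + a\<^sup>2\<close> for \<open>exp (- a)\<close>.\<close>
  have "1 \<le> 1 + a ^ 3"
    using a by simp
  also have "\<dots> = (1 + a) * (1 - a + a\<^sup>2)"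
    by (simp add: algebra_simps power2_eq_square power3_eq_cube)
  also have "\<dots> \<le> exp a * (1 - a + a\<^sup>2)"
    using exp_ge_add_one_self[of a] a by (intro mult_right_mono) auto
  finally have "exp y \<le> 1 - a + a\<^sup>2"
    by (simp add: a_def exp_minus field_simps)
  then have "exp y \<le> 1 + y + y\<^sup>2"
    by (simp add: a_def)
  then show ?thesis
    using exp_ge_add_one_self[of y] zero_le_power2[of y] by linarith
qed

lemma powr_tendsto_0_at_top:
  fixes x :: real
  assumes "0 < x" "x < 1"
  shows "((\<lambda>k. x powr k) \<longlongrightarrow> 0) at_top"
proof -
  have "filterlim (\<lambda>k. ln x * k) at_bot at_top"
    using assms by (intro filterlim_tendsto_neg_mult_at_bot[OF tendsto_const _ filterlim_ident]) simp
  then have "((\<lambda>k. exp (ln x * k)) \<longlongrightarrow> 0) at_top"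
    by (rule filterlim_compose[OF exp_at_bot])
  then show ?thesis
    using assms by (simp add: powr_def mult.commute)
qed

section \<open>Normalized powers of a bounded positive weight on a finite measure space\<close>

locale bounded_weight = finite_measure M for M :: "'a measure" +
  fixes w :: "'a \<Rightarrow> real" and a b :: real
  assumes w_measurable [measurable]: "w \<in> borel_measurable M"
    and a_pos: "0 < a"
    and w_ge: "x \<in> space M \<Longrightarrow> a \<le> w x"
    and w_le: "x \<in> space M \<Longrightarrow> w x \<le> b"
    and space_pos: "0 < measure M (space M)"
begin

text \<open>In the application this is the denominator of \<open>nascent\<close>. What depends only
  on the bounds \<open>a\<close>, \<open>b\<close> and on finiteness of the measure is settled here,
  before any topology enters.\<close>

definition mass :: "real \<Rightarrow> real" where
  "mass k = (\<integral>x. w x powr k \<partial>M)"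

lemma w_pos: "x \<in> space M \<Longrightarrow> 0 < w x"
  using w_ge a_pos by force

text \<open>Powers increase with the base for nonnegative \<open>k\<close> and decrease for negative
  \<open>k\<close>; the sum of the two endpoint values serves both cases at once.\<close>

lemma powr_le: "x \<in> space M \<Longrightarrow> w x powr k \<le> a powr k + b powr k"
  using powr_mono2[of k "w x" b] powr_mono2'[of k a "w x"] w_ge[of x] w_le[of x] a_pos
  by (cases "0 \<le> k") (auto intro: add_increasing add_increasing2)

lemma powr_ge: "x \<in> space M \<Longrightarrow> min (a powr k) (b powr k) \<le> w x powr k"
  using powr_mono2[of k a "w x"] powr_mono2'[of k "w x" b] w_ge[of x] w_le[of x] a_pos
  by (cases "0 \<le> k") (auto simp: min_le_iff_disj)

lemma abs_ln_le: "x \<in> space M \<Longrightarrow> \<bar>ln (w x)\<bar> \<le> \<bar>ln a\<bar> + \<bar>ln b\<bar>"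
  using w_ge[of x] w_le[of x] a_pos ln_mono[of a "w x"] ln_mono[of "w x" b] by linarith

lemma powr_integrable: "integrable M (\<lambda>x. w x powr k)"
  using powr_le by (intro integrable_const_bound[where B = "a powr k + b powr k"]) auto

lemma powr_ln_integrable: "integrable M (\<lambda>x. w x powr k * ln (w x))"
proof (rule integrable_const_bound)
  show "AE x in M. norm (w x powr k * ln (w x)) \<le> (a powr k + b powr k) * (\<bar>ln a\<bar> + \<bar>ln b\<bar>)"
    using powr_le abs_ln_le by (auto simp: abs_mult intro!: mult_mono)
qed simp

lemma mass_pos: "0 < mass k"
proof -
  \<comment> \<open>Positivity of \<open>b\<close> comes from a point of the space: \<open>b\<close>
    dominates a positive value of \<open>w\<close> there.\<close>
  obtain x where "x \<in> space M"
    using space_pos by fastforce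
  then have b_pos: "0 < b"
    using w_pos w_le by force
  have "0 < min (a powr k) (b powr k) * measure M (space M)"
    using a_pos b_pos space_pos by simp
  also have "\<dots> = (\<integral>x. min (a powr k) (b powr k) \<partial>M)"
    by simp
  also have "\<dots> \<le> mass k"
    unfolding mass_def using powr_ge by (intro integral_mono powr_integrable) auto
  finally show ?thesis .
qed

lemma mass_has_derivative:
  "(mass has_real_derivative (\<integral>x. w x powr k * ln (w x) \<partial>M)) (at k)"
proof -
  \<comment> \<open>The summand 1 keeps \<open>L\<close> positive even if both logarithms vanish.
    For \<open>\<bar>h\<bar> < 1 / L\<close> the exponent \<open>h * ln (w x)\<close> lies in the
    range of the exponential estimate; \<open>C\<close> is the resulting pointwise constant
    integrated over the space.\<close>
  define L where "L = \<bar>ln a\<bar> + \<bar>ln b\<bar> + 1"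
  define C where "C = (a powr k + b powr k) * L\<^sup>2 * measure M (space M)"
  let ?D = "\<integral>x. w x powr k * ln (w x) \<partial>M"
  have L: "0 < L"
    by (simp add: L_def add_nonneg_pos)
  have bound: "\<bar>(mass (k + h) - mass k) / h - ?D\<bar> \<le> C * \<bar>h\<bar>" if h: "h \<noteq> 0" "\<bar>h\<bar> < 1 / L" for h
  proof -
    have pointwise: "\<bar>(w x powr (k + h) - w x powr k) / h - w x powr k * ln (w x)\<bar>
        \<le> (a powr k + b powr k) * L\<^sup>2 * \<bar>h\<bar>" if x: "x \<in> space M" for x
    proof -
      have lnL: "\<bar>ln (w x)\<bar> \<le> L"
        using abs_ln_le[OF x] by (simp add: L_def)
      have "\<bar>h * ln (w x)\<bar> \<le> \<bar>h\<bar> * L"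
        using lnL by (simp add: abs_mult mult_left_mono)
      moreover have "\<bar>h\<bar> * L \<le> 1"
        using h L by (simp add: field_simps)
      ultimately have le1: "\<bar>h * ln (w x)\<bar> \<le> 1"
        by linarith
      have split: "w x powr (k + h) = w x powr k * exp (h * ln (w x))"
        using w_pos[OF x] by (simp add: powr_def distrib_right exp_add)
      have "\<bar>(w x powr (k + h) - w x powr k) / h - w x powr k * ln (w x)\<bar>
          = \<bar>w x powr k * ((exp (h * ln (w x)) - 1 - h * ln (w x)) / h)\<bar>"
        unfolding split using h(1) by (simp add: diff_divide_distrib right_diff_distrib)
      also have "\<dots> = w x powr k * (\<bar>exp (h * ln (w x)) - 1 - h * ln (w x)\<bar> / \<bar>h\<bar>)"
        by (simp add: abs_mult)
      also have "\<dots> \<le> w x powr k * ((h * ln (w x))\<^sup>2 / \<bar>h\<bar>)"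
        by (intro mult_left_mono divide_right_mono abs_exp_minus_linear_le[OF le1]) auto
      \<comment> \<open>One factor \<open>\<bar>h\<bar>\<close> cancels the denominator of the
        difference quotient, the other makes the error linear in \<open>h\<close>.\<close>
      also have "(h * ln (w x))\<^sup>2 = (ln (w x))\<^sup>2 * \<bar>h\<bar> * \<bar>h\<bar>"
        by (simp add: power_mult_distrib power2_eq_square)
      also have "\<dots> / \<bar>h\<bar> = (ln (w x))\<^sup>2 * \<bar>h\<bar>"
        using h(1) by simp
      also have "w x powr k * ((ln (w x))\<^sup>2 * \<bar>h\<bar>) \<le> (a powr k + b powr k) * (L\<^sup>2 * \<bar>h\<bar>)"
        using powr_le[OF x] abs_le_square_iff[of "ln (w x)" L] lnL L
        by (intro mult_mono) (auto intro: mult_right_mono)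
      finally show ?thesis
        by (simp add: mult.assoc)
    qed
    have eq: "(mass (k + h) - mass k) / h - ?D
        = (\<integral>x. (w x powr (k + h) - w x powr k) / h - w x powr k * ln (w x) \<partial>M)"
      unfolding mass_def
      by (subst Bochner_Integration.integral_diff)
         (auto intro!: powr_integrable powr_ln_integrable
            simp: Bochner_Integration.integral_diff[OF powr_integrable powr_integrable])
    have "\<bar>(mass (k + h) - mass k) / h - ?D\<bar>
        \<le> (\<integral>x. \<bar>(w x powr (k + h) - w x powr k) / h - w x powr k * ln (w x)\<bar> \<partial>M)"
      unfolding eq by (rule integral_abs_bound)
    also have "\<dots> \<le> (\<integral>x. (a powr k + b powr k) * L\<^sup>2 * \<bar>h\<bar> \<partial>M)"
    proof (rule integral_mono)
      show "integrable M (\<lambda>x. \<bar>(w x powr (k + h) - w x powr k) / h - w x powr k * ln (w x)\<bar>)"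
        by (intro integrable_abs integrable_divide
            Bochner_Integration.integrable_diff powr_integrable powr_ln_integrable)
    qed (simp, rule pointwise)
    also have "\<dots> = C * \<bar>h\<bar>"
      by (simp add: C_def)
    finally show ?thesis .
  qed
  have "(\<lambda>h. (mass (k + h) - mass k) / h - ?D) \<midarrow>0\<rightarrow> 0"
  proof (rule Lim_null_comparison)
    show "\<forall>\<^sub>F h in at 0. norm ((mass (k + h) - mass k) / h - ?D) \<le> C * \<bar>h\<bar>"
      unfolding eventually_at using L bound by (intro exI[of _ "1 / L"]) auto
    show "((\<lambda>h. C * \<bar>h\<bar>) \<longlongrightarrow> 0) (at 0)"
      by (auto intro!: tendsto_eq_intros)
  qed
  then show ?thesis
    unfolding DERIV_def by (rule LIM_zero_cancel)
qed

text \<open>Quotient rule: the logarithmic derivative of \<open>mass\<close> is the mean of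
  \<open>ln w\<close> under the normalized density, and this is the subtracted expectation.\<close>

lemma normalized_has_derivative:
  assumes "x \<in> space M"
  shows "((\<lambda>k. w x powr k / mass k) has_real_derivative
    w x powr k / mass k * (ln (w x) - (\<integral>t. ln (w t) * (w t powr k / mass k) \<partial>M))) (at k)"
proof -
  have "((\<lambda>k. w x powr k / mass k) has_real_derivative
      (w x powr k * ln (w x) * mass k - w x powr k * (\<integral>t. w t powr k * ln (w t) \<partial>M))
        / (mass k * mass k)) (at k)"
    using w_pos[OF assms] mass_pos[of k]
    by (intro DERIV_divide mass_has_derivative)
       (auto simp: powr_def intro!: derivative_eq_intros)
  moreover have "(\<integral>t. ln (w t) * (w t powr k / mass k) \<partial>M)
      = (\<integral>t. w t powr k * ln (w t) \<partial>M) / mass k"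
    by (simp add: mult.commute)
  ultimately show ?thesis
    using mass_pos[of k] by (simp add: field_simps)
qed

text \<open>Dividing by \<open>b\<close> moves the weight into the interval from 0 to 1, where
  powers have a pointwise limit as \<open>k\<close> grows.\<close>

lemma normalized_at_sup:
  assumes "0 < b"
  shows "b powr k / mass k = inverse (\<integral>t. (w t / b) powr k \<partial>M)"
proof -
  have "(\<integral>t. (w t / b) powr k \<partial>M) = (\<integral>t. w t powr k / b powr k \<partial>M)"
    using w_pos assms by (intro Bochner_Integration.integral_cong) (auto simp: powr_divide less_imp_le)
  then show ?thesis
    by (simp add: mass_def)
qed

text \<open>Powers of 1 stay 1 and powers of positive numbers below 1 vanish, so the limit function
  is the indicator of the top level set. The dominating constant 1 is valid once \<open>k\<close> is
  nonnegative.\<close>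

lemma mass_ratio_tendsto:
  assumes "0 < b"
  shows "((\<lambda>k. \<integral>t. (w t / b) powr k \<partial>M) \<longlongrightarrow> measure M {t \<in> space M. w t = b}) at_top"
proof -
  let ?A = "{t \<in> space M. w t = b}"
  have "((\<lambda>k. \<integral>t. (w t / b) powr k \<partial>M) \<longlongrightarrow> (\<integral>t. indicator ?A t \<partial>M)) at_top"
  proof (rule integral_dominated_convergence_at_top)
    show "\<forall>\<^sub>F k in at_top. AE t in M. norm ((w t / b) powr k) \<le> 1"
      using eventually_ge_at_top[of 0]
    proof eventually_elim
      case (elim k)
      have "(w t / b) powr k \<le> 1" if "t \<in> space M" for t
        using w_pos[OF that] w_le[OF that] assms elim by (intro powr_le1) auto
      then show ?case
        by auto
    qed
    have "((\<lambda>k. (w t / b) powr k) \<longlongrightarrow> indicator ?A t) at_top" if t: "t \<in> space M" for t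
    proof (cases "w t = b")
      case True
      then show ?thesis
        using t assms by simp
    next
      case False
      then have "0 < w t / b" "w t / b < 1"
        using w_pos[OF t] w_le[OF t] assms by auto
      then have "((\<lambda>k. (w t / b) powr k) \<longlongrightarrow> 0) at_top"
        by (rule powr_tendsto_0_at_top)
      then show ?thesis
        using False by simp
    qed
    then show "AE t in M. ((\<lambda>k. (w t / b) powr k) \<longlongrightarrow> indicator ?A t) at_top"
      by auto
  qed simp_all
  then show ?thesis
    by simp
qed

lemma normalized_sup_tendsto:
  assumes "0 < b" and "0 < measure M {t \<in> space M. w t = b}"
  shows "((\<lambda>k. b powr k / mass k) \<longlongrightarrow> 1 / measure M {t \<in> space M. w t = b}) at_top"
  unfolding normalized_at_sup[OF assms(1)]
  using tendsto_inverse[OF mass_ratio_tendsto[OF assms(1)]] assms(2)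
  by (simp add: inverse_eq_divide)

lemma normalized_sup_at_top:
  assumes "0 < b" and "measure M {t \<in> space M. w t = b} = 0"
  shows "filterlim (\<lambda>k. b powr k / mass k) at_top at_top"
  unfolding normalized_at_sup[OF assms(1)]
proof (rule filterlim_inverse_at_top)
  show "((\<lambda>k. \<integral>t. (w t / b) powr k \<partial>M) \<longlongrightarrow> 0) at_top"
    using mass_ratio_tendsto[OF assms(1)] assms(2) by simp
  \<comment> \<open>The sign is read off from the identity with \<open>b powr k / mass k\<close>; it
    makes the reciprocal of the vanishing integral tend to plus infinity.\<close>
  have "0 < inverse (\<integral>t. (w t / b) powr k \<partial>M)" for k
    using normalized_at_sup[OF assms(1), of k, symmetric] mass_pos[of k] assms(1) by simp
  then show "\<forall>\<^sub>F k in at_top. 0 < (\<integral>t. (w t / b) powr k \<partial>M)"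
    by simp
qed

text \<open>Keeping only \<open>A\<close> in the normalizer gives
  \<open>c powr k * measure M A \<le> mass k\<close> for nonnegative \<open>k\<close>, so the
  quotient decays like \<open>(d / c) powr k\<close>.\<close>

lemma normalized_tendsto_0:
  assumes A: "A \<in> sets M" "0 < measure M A"
    and c: "\<And>t. t \<in> A \<Longrightarrow> c \<le> w t" and d: "0 < d" "d < c"
  shows "((\<lambda>k. d powr k / mass k) \<longlongrightarrow> 0) at_top"
proof (rule tendsto_sandwich[OF _ _ tendsto_const])
  show "\<forall>\<^sub>F k in at_top. 0 \<le> d powr k / mass k"
    using mass_pos by (auto simp: less_imp_le)
  show "\<forall>\<^sub>F k in at_top. d powr k / mass k \<le> (d / c) powr k / measure M A"
    using eventually_ge_at_top[of 0]
  proof eventually_elim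
    case (elim k)
    have "c powr k * measure M A = (\<integral>t. c powr k * indicator A t \<partial>M)"
      using A by simp
    also have "\<dots> \<le> mass k"
      unfolding mass_def
    proof (intro integral_mono powr_integrable)
      show "integrable M (\<lambda>t. c powr k * indicator A t)"
        using A by (simp add: emeasure_eq_measure)
      show "c powr k * indicator A t \<le> w t powr k" for t
        using c[of t] d elim by (auto simp: indicator_def intro: powr_mono2)
    qed
    finally have "d powr k / mass k \<le> d powr k / (c powr k * measure M A)"
      using A d mass_pos[of k] by (intro divide_left_mono) auto
    also have "\<dots> = (d / c) powr k / measure M A"
      using d by (simp add: powr_divide)
    finally show ?case .
  qed
  have "((\<lambda>k. (d / c) powr k) \<longlongrightarrow> 0) at_top"
    using d by (intro powr_tendsto_0_at_top) auto
  then show "((\<lambda>k. (d / c) powr k / measure M A) \<longlongrightarrow> 0) at_top"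
    by (rule tendsto_divide_zero)
qed

lemma prob_space_normalized: "prob_space (density M (\<lambda>x. ennreal (w x powr k / mass k)))"
proof (rule prob_spaceI)
  have "emeasure (density M (\<lambda>x. ennreal (w x powr k / mass k))) (space M)
      = (\<integral>\<^sup>+x. ennreal (w x powr k / mass k) \<partial>M)"
    by (auto simp: emeasure_density intro!: nn_integral_cong)
  also have "\<dots> = ennreal (\<integral>x. w x powr k / mass k \<partial>M)"
    using mass_pos[of k] by (intro nn_integral_eq_integral integrable_divide powr_integrable) auto
  also have "(\<integral>x. w x powr k / mass k \<partial>M) = 1"
    using mass_pos[of k] by (simp add: mass_def)
  finally show "emeasure (density M (\<lambda>x. ennreal (w x powr k / mass k)))
      (space (density M (\<lambda>x. ennreal (w x powr k / mass k)))) = 1"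
    by simp
qed

end

section \<open>Differentiation rules and positive definiteness\<close>

text \<open>A product rule for a merely continuous factor: the term in which \<open>c\<close> would
  be differentiated carries the factor \<open>g x = 0\<close>. The error splits into
  \<open>c y\<close> times the remainder of \<open>g\<close>, and \<open>c y - c x\<close> times a
  bounded quotient.\<close>

lemma has_derivative_scaleR_continuous:
  fixes g :: "'a::real_normed_vector \<Rightarrow> 'b::real_normed_vector"
  assumes c: "continuous (at x within S) c"
    and g: "(g has_derivative g') (at x within S)" and gx: "g x = 0"
  shows "((\<lambda>y. c y *\<^sub>R g y) has_derivative (\<lambda>h. c x *\<^sub>R g' h)) (at x within S)"
proof -
  interpret g': bounded_linear g'
    using g by (rule has_derivative_bounded_linear)
  obtain K where K: "norm (g' h) \<le> norm h * K" for h
    using g'.bounded by blast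
  have c_lim: "(c \<longlongrightarrow> c x) (at x within S)"
    using c by (simp add: continuous_within)
  have "((\<lambda>y. (1 / norm (y - x)) *\<^sub>R (g y - (g x + g' (y - x)))) \<longlongrightarrow> 0) (at x within S)"
    using g by (simp add: has_derivative_within)
  from tendsto_scaleR[OF c_lim this]
  have remainder: "((\<lambda>y. c y *\<^sub>R ((1 / norm (y - x)) *\<^sub>R (g y - g' (y - x)))) \<longlongrightarrow> 0) (at x within S)"
    by (simp add: gx)
  have "((\<lambda>y. (c y - c x) *\<^sub>R ((1 / norm (y - x)) *\<^sub>R g' (y - x))) \<longlongrightarrow> 0) (at x within S)"
  proof (rule Lim_null_comparison)
    show "\<forall>\<^sub>F y in at x within S.
        norm ((c y - c x) *\<^sub>R ((1 / norm (y - x)) *\<^sub>R g' (y - x))) \<le> \<bar>c y - c x\<bar> * K"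
      unfolding eventually_at_filter
    proof (intro always_eventually allI impI)
      fix y assume "y \<noteq> x"
      then have "norm (g' (y - x)) / norm (y - x) \<le> K"
        using K[of "y - x"] by (simp add: field_simps)
      then show "norm ((c y - c x) *\<^sub>R ((1 / norm (y - x)) *\<^sub>R g' (y - x))) \<le> \<bar>c y - c x\<bar> * K"
        using mult_left_mono[OF _ abs_ge_zero[of "c y - c x"]] by fastforce
    qed
    show "((\<lambda>y. \<bar>c y - c x\<bar> * K) \<longlongrightarrow> 0) (at x within S)"
      using c_lim by (auto intro!: tendsto_eq_intros)
  qed
  \<comment> \<open>In the sum the two occurrences of \<open>c y *\<^sub>R g' (y - x)\<close>
    cancel.\<close>
  from tendsto_add[OF remainder this]
  have "((\<lambda>y. (1 / norm (y - x)) *\<^sub>R (c y *\<^sub>R g y - (c x *\<^sub>R g x + c x *\<^sub>R g' (y - x)))) \<longlongrightarrow> 0)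
      (at x within S)"
    by (rule filterlim_cong[THEN iffD1, rotated -1])
       (auto simp: gx algebra_simps diff_divide_distrib intro!: always_eventually)
  then show ?thesis
    by (simp add: has_derivative_within bounded_linear_scaleR_right g'.bounded_linear_axioms
        bounded_linear_compose[OF bounded_linear_scaleR_right])
qed

lemma has_gradient_compose:
  assumes "(\<phi> has_real_derivative d) (at (f x))" and "has_gradient f v x S"
  shows "has_gradient (\<lambda>y. \<phi> (f y)) (d *\<^sub>R v) x S"
  using DERIV_compose_FDERIV[OF assms(1) assms(2)[unfolded has_gradient_def]]
  by (simp add: has_gradient_def mult.commute)

lemma pos_def_scaleR:
  assumes "0 < c" "pos_def A"
  shows "pos_def (c *\<^sub>R A)"
  using assms by (auto simp: pos_def_def transpose_def vec_eq_iff
      simp flip: scaleR_matrix_vector_assoc)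

section \<open>The density on a compact set: extrema, normalization, uniform case\<close>

locale nascent_minima =
  fixes \<Omega> :: "(real ^ 'n) set" and f :: "real ^ 'n \<Rightarrow> real" and \<rho> :: "real \<Rightarrow> real"
  assumes compact: "compact \<Omega>"
    and measure_pos: "0 < measure lebesgue \<Omega>"
    and f_continuous: "continuous_on \<Omega> f"
    and antimono: "strict_antimono_on UNIV \<rho>"
    and rho_pos: "x \<in> \<Omega> \<Longrightarrow> 0 < \<rho> (f x)"
begin

lemma rho_less_iff: "\<rho> s < \<rho> t \<longleftrightarrow> t < s"
  using antimono by (metis UNIV_I linorder_less_linear monotone_on_def order_less_asym)

lemma rho_le_iff: "\<rho> s \<le> \<rho> t \<longleftrightarrow> t \<le> s"
  using rho_less_iff[of t s] by (simp add: not_less[symmetric])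

lemma nonempty: "\<Omega> \<noteq> {}"
  using measure_pos by auto

lemma lebesgue_set [measurable]: "\<Omega> \<in> sets lebesgue"
  using compact by (simp add: compact_imp_closed borel_closed)

lemma f_ge_Inf: "x \<in> \<Omega> \<Longrightarrow> Inf (f ` \<Omega>) \<le> f x"
  using compact_continuous_image[OF f_continuous compact]
  by (intro cInf_lower) (auto dest: compact_imp_bounded bounded_imp_bdd_below)

lemma f_le_Sup: "x \<in> \<Omega> \<Longrightarrow> f x \<le> Sup (f ` \<Omega>)"
  using compact_continuous_image[OF f_continuous compact]
  by (intro cSup_upper) (auto dest: compact_imp_bounded bounded_imp_bdd_above)

lemma Inf_attained: "Inf (f ` \<Omega>) \<in> f ` \<Omega>"
  using compact_continuous_image[OF f_continuous compact] nonempty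
  by (intro closed_contains_Inf)
     (auto intro: compact_imp_closed dest: compact_imp_bounded bounded_imp_bdd_below)

lemma Sup_attained: "Sup (f ` \<Omega>) \<in> f ` \<Omega>"
  using compact_continuous_image[OF f_continuous compact] nonempty
  by (intro closed_contains_Sup)
     (auto intro: compact_imp_closed dest: compact_imp_bounded bounded_imp_bdd_above)

text \<open>Compactness makes the infimum attained, so minimality turns into an equation; in
  particular \<open>f\<close>, and hence \<open>tau\<close>, agree at all minimizers.\<close>

lemma global_minimizers_eq: "global_minimizers f \<Omega> = {x \<in> \<Omega>. f x = Inf (f ` \<Omega>)}"
proof -
  obtain z where "z \<in> \<Omega>" "f z = Inf (f ` \<Omega>)"
    using Inf_attained by auto
  then show ?thesis
    using f_ge_Inf by (fastforce simp: global_minimizers_def is_arg_min_def not_less intro: antisym)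
qed

text \<open>Measurability comes from monotonicity: the negative of \<open>\<rho>\<close> is
  increasing, hence Borel.\<close>

lemma rho_measurable [measurable]: "\<rho> \<in> borel_measurable borel"
proof -
  have "mono (\<lambda>t. - \<rho> t)"
    by (auto simp: mono_def rho_le_iff)
  then have "(\<lambda>t. - (- \<rho> t)) \<in> borel_measurable borel"
    by (intro borel_measurable_uminus borel_measurable_mono)
  then show ?thesis
    by simp
qed

text \<open>As \<open>\<rho>\<close> reverses the order, the maximum of \<open>f\<close> gives the
  lower bound of \<open>tau\<close> and the minimum the upper one. The lower bound is positive
  because the maximum is attained.\<close>

sublocale bounded_weight "lebesgue_on \<Omega>" "tau \<rho> f" "\<rho> (Sup (f ` \<Omega>))" "\<rho> (Inf (f ` \<Omega>))"
proof (intro bounded_weight.intro bounded_weight_axioms.intro finite_measureI)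
  show "emeasure (lebesgue_on \<Omega>) (space (lebesgue_on \<Omega>)) \<noteq> \<infinity>"
    using lmeasurable_compact[OF compact] by (simp add: emeasure_restrict_space fmeasurable_def)
  have [measurable]: "f \<in> borel_measurable (lebesgue_on \<Omega>)"
    by (rule continuous_imp_measurable_on_sets_lebesgue[OF f_continuous lebesgue_set])
  show "tau \<rho> f \<in> borel_measurable (lebesgue_on \<Omega>)"
    unfolding tau_def[abs_def] by measurable
  show "0 < \<rho> (Sup (f ` \<Omega>))"
    using Sup_attained rho_pos by auto
  show "0 < measure (lebesgue_on \<Omega>) (space (lebesgue_on \<Omega>))"
    using measure_pos by (simp add: measure_restrict_space)
qed (auto simp: tau_def rho_le_iff f_ge_Inf f_le_Sup)

lemma set_integral_eq: "(LINT t:\<Omega>|lebesgue. h t) = (\<integral>t. h t \<partial>lebesgue_on \<Omega>)" for h :: "real ^ 'n \<Rightarrow> real"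
  by (simp add: set_lebesgue_integral_def integral_restrict_space)

lemma nascent_eq: "nascent \<rho> f \<Omega> k x = tau \<rho> f x powr k / mass k"
  by (simp add: nascent_def mass_def set_integral_eq)

lemma tau_pos: "x \<in> \<Omega> \<Longrightarrow> 0 < tau \<rho> f x"
  using rho_pos by (simp add: tau_def)

text \<open>The common positive normalizer cancels, powers with \<open>0 < k\<close> preserve the
  order, and \<open>\<rho>\<close> reverses it.\<close>

lemma nascent_le_iff:
  assumes "0 < k" "x \<in> \<Omega>" "y \<in> \<Omega>"
  shows "nascent \<rho> f \<Omega> k x \<le> nascent \<rho> f \<Omega> k y \<longleftrightarrow> f y \<le> f x"
proof -
  have "nascent \<rho> f \<Omega> k x \<le> nascent \<rho> f \<Omega> k y \<longleftrightarrow> tau \<rho> f x powr k \<le> tau \<rho> f y powr k"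
    using mass_pos[of k] by (simp add: nascent_eq divide_le_cancel)
  also have "\<dots> \<longleftrightarrow> tau \<rho> f x \<le> tau \<rho> f y"
    using assms tau_pos[of x] tau_pos[of y] powr_less_mono2[of k "tau \<rho> f y" "tau \<rho> f x"]
      powr_mono2[of k "tau \<rho> f x" "tau \<rho> f y"] by (meson less_imp_le not_le)
  finally show ?thesis
    by (simp add: tau_def rho_le_iff)
qed

lemma global_maximizers_nascent:
  assumes "0 < k"
  shows "global_maximizers (nascent \<rho> f \<Omega> k) \<Omega> = global_minimizers f \<Omega>"
  using nascent_le_iff[OF assms]
  by (auto simp: global_minimizers_def global_maximizers_def is_arg_min_def is_arg_max_def not_less)

lemma nascent_nonneg: "0 \<le> nascent \<rho> f \<Omega> k x"
  using mass_pos[of k] by (simp add: nascent_eq)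

lemma nascent_measurable [measurable]: "nascent \<rho> f \<Omega> k \<in> borel_measurable (lebesgue_on \<Omega>)"
  unfolding nascent_eq[abs_def] by measurable

lemma probability_density: "probability_density_on \<Omega> (nascent \<rho> f \<Omega> k)"
  using prob_space_normalized[of k] nascent_nonneg nascent_measurable
  by (auto simp: probability_density_on_def nascent_eq)

lemma nascent_0: "x \<in> \<Omega> \<Longrightarrow> nascent \<rho> f \<Omega> 0 x = 1 / measure lebesgue \<Omega>"
proof -
  assume "x \<in> \<Omega>"
  \<comment> \<open>\<open>0 powr 0\<close> is 0, so replacing the integrand by 1 relies on
    \<open>tau\<close> being positive on \<Omega>.\<close>
  have "mass 0 = (\<integral>t. 1 \<partial>lebesgue_on \<Omega>)"
    unfolding mass_def by (rule Bochner_Integration.integral_cong) (auto dest: tau_pos)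
  with \<open>x \<in> \<Omega>\<close> tau_pos[of x] show ?thesis
    by (simp add: nascent_eq measure_restrict_space)
qed

lemma density_nascent_0:
  "density (lebesgue_on \<Omega>) (\<lambda>x. ennreal (nascent \<rho> f \<Omega> 0 x)) = uniform_measure (lebesgue_on \<Omega>) \<Omega>"
  unfolding uniform_measure_def
proof (rule density_cong)
  have "emeasure (lebesgue_on \<Omega>) \<Omega> = ennreal (measure lebesgue \<Omega>)"
    by (simp add: emeasure_eq_measure measure_restrict_space)
  then show "AE x in lebesgue_on \<Omega>. ennreal (nascent \<rho> f \<Omega> 0 x)
      = indicator \<Omega> x / emeasure (lebesgue_on \<Omega>) \<Omega>"
    using measure_pos by (auto simp: nascent_0 divide_ennreal simp flip: ennreal_1)
next
  have [measurable]: "\<Omega> \<in> sets (lebesgue_on \<Omega>)"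
    by (simp add: sets_restrict_space_iff)
  show "(\<lambda>x. indicator \<Omega> x / emeasure (lebesgue_on \<Omega>) \<Omega>) \<in> borel_measurable (lebesgue_on \<Omega>)"
    by measurable
qed simp

section \<open>Gradient, Hessian and derivative in the parameter\<close>

lemma nascent_has_gradient:
  assumes "x \<in> \<Omega>" and v: "has_gradient (tau \<rho> f) v x \<Omega>"
  shows "has_gradient (nascent \<rho> f \<Omega> k) ((k * nascent \<rho> f \<Omega> k x / tau \<rho> f x) *\<^sub>R v) x \<Omega>"
proof -
  have "((\<lambda>s. s powr k / mass k) has_real_derivative
      k * nascent \<rho> f \<Omega> k x / tau \<rho> f x) (at (tau \<rho> f x))"
    using tau_pos[OF assms(1)] mass_pos[of k]
    by (auto intro!: derivative_eq_intros simp: nascent_eq powr_diff)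
  from has_gradient_compose[OF this v] show ?thesis
    by (simp add: nascent_eq[abs_def])
qed

lemma minimizer_has_hessian:
  assumes C2: "C2_on \<Omega> f g H" and x: "x \<in> global_minimizers f \<Omega>"
    and crit: "x \<in> interior \<Omega> \<or> g x = 0"
    and U: "open U" "f ` \<Omega> \<subseteq> U" "\<rho> differentiable_on U" "continuous_on U (deriv \<rho>)"
  shows "has_jacobian (\<lambda>y. (k * nascent \<rho> f \<Omega> k y / tau \<rho> f y * deriv \<rho> (f y)) *\<^sub>R g y)
    ((k * nascent \<rho> f \<Omega> k x / tau \<rho> f x * deriv \<rho> (f x)) *\<^sub>R H x) x \<Omega>"
proof -
  have x\<Omega>: "x \<in> \<Omega>"
    using x by (simp add: global_minimizers_eq)
  \<comment> \<open>At an interior point the relative derivative is the ordinary one, so Fermat's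
    criterion applies; otherwise criticality is given by \<open>crit\<close>.\<close>
  have "g x = 0"
  proof (cases "g x = 0")
    case False
    then have "x \<in> interior \<Omega>"
      using crit by simp
    moreover have "has_gradient f (g x) x \<Omega>"
      using C2 x\<Omega> by (simp add: C2_on_def gradient_on_def)
    then have "(f has_derivative (\<lambda>h. h \<bullet> g x)) (at x)"
      unfolding has_gradient_def at_within_interior[OF \<open>x \<in> interior \<Omega>\<close>] .
    moreover have "\<forall>y\<in>interior \<Omega>. f x \<le> f y"
      using x f_ge_Inf interior_subset[of \<Omega>] by (auto simp: global_minimizers_eq)
    ultimately have "(\<lambda>h. h \<bullet> g x) = (\<lambda>h. 0)"
      by (intro differential_zero_maxmin[of x "interior \<Omega>" f]) auto
    \<comment> \<open>The vanishing linear form is evaluated at the gradient itself.\<close>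
    then have "g x \<bullet> g x = 0"
      by metis
    then show ?thesis
      by simp
  qed simp
  have "continuous_on U \<rho>"
    using U(3) by (rule differentiable_imp_continuous_on)
  then have "continuous_on \<Omega> (tau \<rho> f)" "continuous_on \<Omega> (\<lambda>y. deriv \<rho> (f y))"
    unfolding tau_def[abs_def] using U f_continuous by (auto intro: continuous_on_compose2)
  then have "continuous_on \<Omega> (\<lambda>y. k * nascent \<rho> f \<Omega> k y / tau \<rho> f y * deriv \<rho> (f y))"
    unfolding nascent_eq using tau_pos mass_pos[of k]
    by (intro continuous_intros) (auto simp: less_imp_neq[symmetric] dest: tau_pos)
  then have "continuous (at x within \<Omega>) (\<lambda>y. k * nascent \<rho> f \<Omega> k y / tau \<rho> f y * deriv \<rho> (f y))"
    using x\<Omega> by (simp add: continuous_on_eq_continuous_within)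
  moreover have "(g has_derivative (\<lambda>h. H x *v h)) (at x within \<Omega>)"
    using C2 x\<Omega> by (auto simp: C2_on_def has_jacobian_def)
  ultimately show ?thesis
    using \<open>g x = 0\<close> unfolding has_jacobian_def scaleR_matrix_vector_assoc[symmetric]
    by (rule has_derivative_scaleR_continuous)
qed

lemma nascent_gradient_on:
  assumes g: "gradient_on \<Omega> f g"
    and U: "open U" "f ` \<Omega> \<subseteq> U" "\<rho> differentiable_on U"
  shows "gradient_on \<Omega> (nascent \<rho> f \<Omega> k)
    (\<lambda>y. (k * nascent \<rho> f \<Omega> k y / tau \<rho> f y * deriv \<rho> (f y)) *\<^sub>R g y)"
  unfolding gradient_on_def
proof
  fix y assume y: "y \<in> \<Omega>"
  have "(\<rho> has_real_derivative deriv \<rho> (f y)) (at (f y))"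
    using U y by (metis DERIV_deriv_iff_real_differentiable
        differentiable_on_eq_differentiable_at image_subset_iff)
  then have "has_gradient (tau \<rho> f) (deriv \<rho> (f y) *\<^sub>R g y) y \<Omega>"
    unfolding tau_def[abs_def] using g y by (intro has_gradient_compose) (auto simp: gradient_on_def)
  from nascent_has_gradient[OF y this, of k]
  show "has_gradient (nascent \<rho> f \<Omega> k)
      ((k * nascent \<rho> f \<Omega> k y / tau \<rho> f y * deriv \<rho> (f y)) *\<^sub>R g y) y \<Omega>"
    by simp
qed

text \<open>All minimizers share the value of \<open>f\<close>, hence the prefactor
  \<open>c\<close>. Both Hessians of the density are the same negative multiple of those of
  \<open>f\<close>, which reverses the Loewner order.\<close>

lemma hessian_comparison:
  assumes C2: "C2_on \<Omega> f g H"
    and x1: "x1 \<in> global_minimizers f \<Omega>" "x1 \<in> interior \<Omega> \<or> g x1 = 0"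
    and x2: "x2 \<in> global_minimizers f \<Omega>" "x2 \<in> interior \<Omega> \<or> g x2 = 0"
    and reg: "regular_decreasing \<rho> (f ` \<Omega>) (f x1)"
    and H: "H x2 \<prec>\<^sub>L H x1" "0 \<prec>\<^sub>L H x2" and k: "0 < k"
  shows "\<exists>G K1 K2. gradient_on \<Omega> (nascent \<rho> f \<Omega> k) G \<and>
    has_jacobian G K1 x1 \<Omega> \<and> has_jacobian G K2 x2 \<Omega> \<and> K1 \<prec>\<^sub>L K2 \<and> K2 \<prec>\<^sub>L 0"
proof -
  obtain U where U: "open U" "f ` \<Omega> \<subseteq> U" "\<rho> differentiable_on U" "continuous_on U (deriv \<rho>)"
    and neg: "deriv \<rho> (f x1) < 0"
    using reg by (auto simp: regular_decreasing_def)
  define c where "c = k * nascent \<rho> f \<Omega> k x1 / tau \<rho> f x1 * deriv \<rho> (f x1)"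
  have x1\<Omega>: "x1 \<in> \<Omega>" and same: "f x2 = f x1"
    using x1 x2 by (auto simp: global_minimizers_eq)
  have c2: "k * nascent \<rho> f \<Omega> k x2 / tau \<rho> f x2 * deriv \<rho> (f x2) = c"
    by (simp add: c_def nascent_eq tau_def same)
  have "0 < k * nascent \<rho> f \<Omega> k x1 / tau \<rho> f x1"
    using k tau_pos[OF x1\<Omega>] mass_pos[of k] by (simp add: nascent_eq)
  then have c_neg: "0 < - c"
    using mult_pos_neg[OF _ neg] by (simp only: c_def neg_0_less_iff_less)
  have less: "c *\<^sub>R H x1 \<prec>\<^sub>L c *\<^sub>R H x2" "c *\<^sub>R H x2 \<prec>\<^sub>L 0"
    using pos_def_scaleR[OF c_neg, of "H x1 - H x2"] pos_def_scaleR[OF c_neg, of "H x2"] H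
    by (simp_all add: loewner_less_def scaleR_diff_right)
  have "gradient_on \<Omega> f g"
    using C2 by (simp add: C2_on_def)
  from nascent_gradient_on[OF this U(1-3), of k]
    minimizer_has_hessian[OF C2 x1 U, of k, folded c_def]
    minimizer_has_hessian[OF C2 x2 U, of k, unfolded c2] less
  show ?thesis
    by (intro exI conjI)
qed

lemma nascent_has_derivative:
  assumes "x \<in> \<Omega>"
  shows "((\<lambda>k. nascent \<rho> f \<Omega> k x) has_real_derivative
    nascent \<rho> f \<Omega> k x *
      (ln (tau \<rho> f x) - nascent_expectation \<rho> f \<Omega> k (\<lambda>t. ln (tau \<rho> f t)))) (at k)"
  using normalized_has_derivative[of x k] assms
  by (simp add: nascent_expectation_def set_integral_eq nascent_eq)

section \<open>Limits for large parameter\<close>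

lemma measure_minimizers:
  "measure (lebesgue_on \<Omega>) {t \<in> space (lebesgue_on \<Omega>). tau \<rho> f t = \<rho> (Inf (f ` \<Omega>))}
    = measure lebesgue (global_minimizers f \<Omega>)"
proof -
  \<comment> \<open>Strict monotonicity makes \<open>\<rho>\<close> injective, so the top level set
    of \<open>tau\<close> contains nothing but minimizers.\<close>
  have "{t \<in> space (lebesgue_on \<Omega>). tau \<rho> f t = \<rho> (Inf (f ` \<Omega>))} = global_minimizers f \<Omega>"
    by (auto simp: global_minimizers_eq tau_def eq_iff rho_le_iff)
  then show ?thesis
    by (simp add: measure_restrict_space global_minimizers_eq)
qed

lemma nascent_minimizer:
  "x \<in> global_minimizers f \<Omega> \<Longrightarrow> nascent \<rho> f \<Omega> k x = \<rho> (Inf (f ` \<Omega>)) powr k / mass k"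
  by (simp add: nascent_eq tau_def global_minimizers_eq)

lemma rho_Inf_pos: "0 < \<rho> (Inf (f ` \<Omega>))"
  using Inf_attained rho_pos by auto

lemma nascent_tendsto_0:
  assumes x: "x \<in> \<Omega>" and A: "A \<subseteq> \<Omega>" "A \<in> sets lebesgue" "0 < measure lebesgue A"
    and s: "s < f x" "\<And>t. t \<in> A \<Longrightarrow> f t \<le> s"
  shows "((\<lambda>k. nascent \<rho> f \<Omega> k x) \<longlongrightarrow> 0) at_top"
  unfolding nascent_eq
proof (rule normalized_tendsto_0)
  show "A \<in> sets (lebesgue_on \<Omega>)"
    using A by (simp add: sets_restrict_space_iff)
  show "0 < measure (lebesgue_on \<Omega>) A"
    using A by (simp add: measure_restrict_space)
  show "\<rho> s \<le> tau \<rho> f t" if "t \<in> A" for t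
    using s that by (simp add: tau_def rho_le_iff)
  show "0 < tau \<rho> f x" "tau \<rho> f x < \<rho> s"
    using x s tau_pos by (auto simp: tau_def rho_less_iff)
qed

text \<open>By continuity \<open>f\<close> stays below the midpoint of \<open>f z\<close> and
  \<open>f x\<close> on the part of \<Omega> in a small ball around \<open>z\<close>, and this part
  has positive measure by the choice of \<open>z\<close>.\<close>

lemma nascent_tendsto_0_nonnegligible:
  assumes z: "z \<in> global_minimizers f \<Omega>" "z \<in> nonnegligible_points \<Omega>"
    and x: "x \<in> \<Omega>" "x \<notin> global_minimizers f \<Omega>"
  shows "((\<lambda>k. nascent \<rho> f \<Omega> k x) \<longlongrightarrow> 0) at_top"
proof -
  have z\<Omega>: "z \<in> \<Omega>" and less: "f z < f x"
    using z x f_ge_Inf[OF x(1)] by (auto simp: global_minimizers_eq)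
  define s where "s = (f z + f x) / 2"
  have s: "f z < s" "s < f x"
    using less by (auto simp: s_def)
  obtain e where e: "0 < e" "\<And>t. t \<in> \<Omega> \<Longrightarrow> dist t z < e \<Longrightarrow> dist (f t) (f z) < s - f z"
    using f_continuous z\<Omega> s(1) unfolding continuous_on_iff by (metis diff_gt_0_iff_gt)
  show ?thesis
  proof (rule nascent_tendsto_0[OF x(1)])
    show "\<Omega> \<inter> ball z e \<in> sets lebesgue"
      by (intro sets.Int lebesgue_set) simp
    show "0 < measure lebesgue (\<Omega> \<inter> ball z e)"
      using z e by (simp add: nonnegligible_points_def)
    show "f t \<le> s" if "t \<in> \<Omega> \<inter> ball z e" for t
      using e(2)[of t] that by (auto simp: dist_real_def dist_commute)
  qed (use s in auto)
qed

lemma nascent_tendsto_0_measure_pos: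
  assumes "0 < measure lebesgue (global_minimizers f \<Omega>)"
    and x: "x \<in> \<Omega>" "x \<notin> global_minimizers f \<Omega>"
  shows "((\<lambda>k. nascent \<rho> f \<Omega> k x) \<longlongrightarrow> 0) at_top"
proof (rule nascent_tendsto_0[OF x(1) _ _ assms(1)])
  show "global_minimizers f \<Omega> \<in> sets lebesgue"
    \<comment> \<open>A set outside the sigma-algebra has \<open>measure\<close> 0 by default, so
      positive measure already certifies measurability.\<close>
    using assms(1) measure_notin_sets by force
  show "Inf (f ` \<Omega>) < f x"
    using x f_ge_Inf[OF x(1)] by (auto simp: global_minimizers_eq)
qed (auto simp: global_minimizers_eq)

end

text \<open>Some clauses carry conditions that exclude real failures. The gradient of
  \<open>tau\<close> is only asserted to exist where \<open>\<rho>\<close> is differentiable, since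
  a decreasing function may have corners and jumps. The Hessian order needs \<open>0 < k\<close>:
  for \<open>k = 0\<close> the density is constant, and for negative \<open>k\<close> the factor
  \<open>c\<close> changes sign. A boundary minimizer may have nonzero gradient, and then further
  terms enter the Hessian. If the only minimizer is an isolated point of \<Omega>, the normalizer
  does not see it and the density may even blow up at other points; this is why a minimizer in
  \<open>nonnegligible_points\<close> is required.\<close>

theorem theorem1:
  fixes \<Omega> :: "(real ^ 'n) set" and f :: "real ^ 'n \<Rightarrow> real" and \<rho> :: "real \<Rightarrow> real"
  assumes "compact \<Omega>" and "0 < measure lebesgue \<Omega>"
    and "continuous_on \<Omega> f"
    and "strict_antimono_on UNIV \<rho>"
    and "\<forall>x\<in>\<Omega>. 0 < \<rho> (f x)"
  shows
    \<comment> \<open>(i)\<close>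
    "(\<forall>k>0. global_minimizers f \<Omega> \<noteq> {} \<and>
        (\<forall>xs\<in>global_minimizers f \<Omega>. \<forall>x\<in>\<Omega>. nascent \<rho> f \<Omega> k x \<le> nascent \<rho> f \<Omega> k xs) \<and>
        global_maximizers (nascent \<rho> f \<Omega> k) \<Omega> = global_minimizers f \<Omega>)
    \<and>
    \<comment> \<open>(ii)\<close>
    (\<forall>k. probability_density_on \<Omega> (nascent \<rho> f \<Omega> k)) \<and>
    (\<forall>x\<in>\<Omega>. nascent \<rho> f \<Omega> 0 x = 1 / measure lebesgue \<Omega>) \<and>
    density (lebesgue_on \<Omega>) (\<lambda>x. ennreal (nascent \<rho> f \<Omega> 0 x)) = uniform_measure (lebesgue_on \<Omega>) \<Omega>
    \<and>
    \<comment> \<open>(iii)\<close>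
    (C1_on \<Omega> f \<longrightarrow>
      (\<forall>k. \<forall>x\<in>\<Omega>.
        (\<rho> differentiable (at (f x)) \<longrightarrow> (\<exists>v. has_gradient (tau \<rho> f) v x \<Omega>)) \<and>
        (\<forall>v. has_gradient (tau \<rho> f) v x \<Omega> \<longrightarrow>
          has_gradient (nascent \<rho> f \<Omega> k) ((k * nascent \<rho> f \<Omega> k x / tau \<rho> f x) *\<^sub>R v) x \<Omega>)))
    \<and>
    \<comment> \<open>(iv)\<close>
    (\<forall>g H x1 x2. C2_on \<Omega> f g H \<and>
        x1 \<in> global_minimizers f \<Omega> \<and> x2 \<in> global_minimizers f \<Omega> \<and>
        (x1 \<in> interior \<Omega> \<or> g x1 = 0) \<and> (x2 \<in> interior \<Omega> \<or> g x2 = 0) \<and>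
        regular_decreasing \<rho> (f ` \<Omega>) (f x1) \<and>
        H x2 \<prec>\<^sub>L H x1 \<and> 0 \<prec>\<^sub>L H x2 \<longrightarrow>
      (\<forall>k>0. \<exists>G K1 K2. gradient_on \<Omega> (nascent \<rho> f \<Omega> k) G \<and>
        has_jacobian G K1 x1 \<Omega> \<and> has_jacobian G K2 x2 \<Omega> \<and>
        K1 \<prec>\<^sub>L K2 \<and> K2 \<prec>\<^sub>L 0))
    \<and>
    \<comment> \<open>(v)\<close>
    (\<forall>k. \<forall>x\<in>\<Omega>. ((\<lambda>k. nascent \<rho> f \<Omega> k x) has_real_derivative
        nascent \<rho> f \<Omega> k x *
          (ln (tau \<rho> f x) - nascent_expectation \<rho> f \<Omega> k (\<lambda>t. ln (tau \<rho> f t)))) (at k))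
    \<and>
    \<comment> \<open>(vi)\<close>
    (measure lebesgue (global_minimizers f \<Omega>) = 0 \<longrightarrow>
      (\<forall>x\<in>global_minimizers f \<Omega>. filterlim (\<lambda>k. nascent \<rho> f \<Omega> k x) at_top at_top) \<and>
      (global_minimizers f \<Omega> \<inter> nonnegligible_points \<Omega> \<noteq> {} \<longrightarrow>
        (\<forall>x\<in>\<Omega> - global_minimizers f \<Omega>. ((\<lambda>k. nascent \<rho> f \<Omega> k x) \<longlongrightarrow> 0) at_top)))
    \<and>
    \<comment> \<open>(vii)\<close>
    (0 < measure lebesgue (global_minimizers f \<Omega>) \<longrightarrow>
      (\<forall>x\<in>global_minimizers f \<Omega>.
        ((\<lambda>k. nascent \<rho> f \<Omega> k x) \<longlongrightarrow> 1 / measure lebesgue (global_minimizers f \<Omega>)) at_top) \<and>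
      (\<forall>x\<in>\<Omega> - global_minimizers f \<Omega>. ((\<lambda>k. nascent \<rho> f \<Omega> k x) \<longlongrightarrow> 0) at_top))"
proof -
  interpret nascent_minima \<Omega> f \<rho>
    using assms by unfold_locales auto
  have nonempty: "global_minimizers f \<Omega> \<noteq> {}"
    using Inf_attained by (auto simp: global_minimizers_eq)
  have max: "nascent \<rho> f \<Omega> k x \<le> nascent \<rho> f \<Omega> k xs"
    if "0 < k" "xs \<in> global_minimizers f \<Omega>" "x \<in> \<Omega>" for k x xs
    using nascent_le_iff[of k x xs] f_ge_Inf that by (simp add: global_minimizers_eq)
  have gradient: "\<exists>v. has_gradient (tau \<rho> f) v x \<Omega>"
    if "C1_on \<Omega> f" "x \<in> \<Omega>" "\<rho> differentiable (at (f x))" for x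
  proof -
    obtain g where "has_gradient f (g x) x \<Omega>"
      using \<open>C1_on \<Omega> f\<close> \<open>x \<in> \<Omega>\<close> by (auto simp: C1_on_def gradient_on_def)
    with that(3)[folded DERIV_deriv_iff_real_differentiable] show ?thesis
      unfolding tau_def[abs_def] by (blast intro: has_gradient_compose)
  qed
  have at_top: "filterlim (\<lambda>k. nascent \<rho> f \<Omega> k x) at_top at_top"
    if "measure lebesgue (global_minimizers f \<Omega>) = 0" "x \<in> global_minimizers f \<Omega>" for x
    using normalized_sup_at_top[OF rho_Inf_pos] that(1)
    unfolding measure_minimizers nascent_minimizer[OF that(2)] by blast
  have limit: "((\<lambda>k. nascent \<rho> f \<Omega> k x) \<longlongrightarrow> 1 / measure lebesgue (global_minimizers f \<Omega>)) at_top"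
    if "0 < measure lebesgue (global_minimizers f \<Omega>)" "x \<in> global_minimizers f \<Omega>" for x
    using normalized_sup_tendsto[OF rho_Inf_pos] that(1)
    unfolding measure_minimizers nascent_minimizer[OF that(2)] by blast
  show ?thesis
    apply (intro conjI allI impI ballI)
    subgoal by (rule nonempty)
    subgoal by (rule max)
    subgoal by (rule global_maximizers_nascent)
    subgoal by (rule probability_density)
    subgoal by (rule nascent_0)
    subgoal by (rule density_nascent_0)
    subgoal by (rule gradient)
    subgoal by (rule nascent_has_gradient)
    subgoal by (elim conjE) (rule hessian_comparison)
    subgoal by (rule nascent_has_derivative)
    subgoal by (rule at_top)
    subgoal by (blast intro: nascent_tendsto_0_nonnegligible)
    subgoal by (rule limit)
    subgoal by (blast intro: nascent_tendsto_0_measure_pos)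
    done
qed

end
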